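(* Let $\nu,D_+,D_-,\lambda_{\mathrm D},\gamma>0$ and $E_0,U_+,U_-\in\mathbb R$. For every $\lambda_{\mathrm D},c_0>0$ and $\zeta_+,\zeta_-\in\mathbb R$, the Poisson--Boltzmann problem $$-\lambda_{\mathrm D}^2\phi_*''=c_0e^{-\phi_*}-c_0e^{\phi_*}\quad\text{on }(-1,1),\qquad \phi_*(\pm1)=\zeta_\pm,$$ has a unique smooth solution $\phi_*$. With $\chi:=\gamma\lambda_{\mathrm D}^2/\nu$, the Poisson--Nernst--Planck--Navier--Stokes boundary value problem stated in the context admits the steady state $(\mathbf u,p,c_+,c_-,\phi)=(\mathbf u_*,p_*,c_{+,*},c_{-,*},\phi_* )$ given by $$c_{+,*}(y)=c_0e^{-\phi_*(y)},\qquad c_{-,*}(y)=c_0e^{\phi_*(y)},\qquad \varrho_*(y)=c_{+,*}(y)-c_{-,*}(y),$$ $$\mathbf u_*(y)=U_*(y)\mathbf e_1,\qquad U_*(y)=U_{\mathrm C}(y)+\chi E_0\bigl(\phi_*(y)-\ell_\zeta(y)\bigr),$$ $$p_*(y)=\gamma\bigl(c_{+,*}(y)+c_{-,*}(y)\bigr)+p_0,\qquad p_0\in\mathbb R .$$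
   Context: Let $\mathbb T_{2\pi}=\mathbb R/2\pi\mathbb Z$, $\Omega=\mathbb T_{2\pi}\times(-1,1)$ with coordinates $(x,y)$, and $\mathbf e_1=(1,0)$. All fields (including the pressure) are $2\pi$-periodic in $x$; no independent mean pressure gradient is imposed. The system for velocity $\mathbf u=(u_1,u_2)$, pressure $p$, concentrations $c_\pm$ and potential $\phi$ is $$\partial_t\mathbf u+(\mathbf u\cdot\nabla)\mathbf u+\nabla p=\nu\Delta\mathbf u+\gamma\varrho(E_0\mathbf e_1-\nabla\phi),\qquad \operatorname{div}\mathbf u=0,$$ $$\partial_tc_++\mathbf u\cdot\nabla c_+=D_+\operatorname{div}(\nabla c_++c_+\nabla\phi-E_0c_+\mathbf e_1),$$ $$\partial_tc_-+\mathbf u\cdot\nabla c_-=D_-\operatorname{div}(\nabla c_--c_-\nabla\phi+E_0c_-\mathbf e_1),$$ $$-\lambda_{\mathrm D}^2\Delta\phi=\varrho:=c_+-c_-,$$ with boundary data $$\mathbf u(x,\pm1,t)=(U_\pm,0),\quad \phi(x,\pm1,t)=\zeta_\pm,\quad c_+(x,\pm1,t)=c_0e^{-\zeta_\pm},\quad c_-(x,\pm1,t)=c_0e^{\zeta_\pm}.$$ Moreover $U_{\mathrm C}(y):=Ay+B$ with $A:=(U_+-U_-)/2$, $B:=(U_++U_-)/2$, and $\ell_\zeta(y):=\frac{1+y}{2}\zeta_++\frac{1-y}{2}\zeta_-$. *)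

theory Defs
  imports "HOL-Analysis.Analysis"
begin

(* smooth_on S f: f is of class C^infinity on S, i.e. f is differentiable on S and every
   directional derivative of f is again smooth on S.  Derivatives are taken within S, so for a
   set with boundary (a closed interval, a closed strip) this means smooth up to the boundary.
   It is meant for convex sets with nonempty interior and for open sets, where derivatives
   within S are unique. *)
coinductive smooth_on ::
    "'a::euclidean_space set \<Rightarrow> ('a \<Rightarrow> 'b::real_normed_vector) \<Rightarrow> bool" for S where
  "\<lbrakk>\<And>z. z \<in> S \<Longrightarrow> (f has_derivative f' z) (at z within S);
    \<And>v. smooth_on S (\<lambda>z. f' z v)\<rbrakk> \<Longrightarrow> smooth_on S f"

text \<open>Functions on the periodic channel are functions on the strip
  \<open>\<real> \<times> [-1,1]\<close> that are \<open>2\<pi>\<close>-periodic in the first coordinate.\<close>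

definition channel :: "(real \<times> real) set" where
  "channel = UNIV \<times> {-1<..<1}"

definition closed_channel :: "(real \<times> real) set" where
  "closed_channel = UNIV \<times> {-1..1}"

definition x_periodic :: "(real \<times> real \<Rightarrow> 'b) \<Rightarrow> bool" where
  "x_periodic f \<longleftrightarrow> (\<forall>x. \<forall>y\<in>{-1..1}. f (x + 2 * pi, y) = f (x, y))"

definition e1 :: "real \<times> real" where
  "e1 = (1, 0)"

definition dx :: "(real \<times> real \<Rightarrow> 'b::real_normed_vector) \<Rightarrow> real \<times> real \<Rightarrow> 'b" where
  "dx f z = frechet_derivative f (at z) (1, 0)"

definition dy :: "(real \<times> real \<Rightarrow> 'b::real_normed_vector) \<Rightarrow> real \<times> real \<Rightarrow> 'b" where
  "dy f z = frechet_derivative f (at z) (0, 1)"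

definition grad :: "(real \<times> real \<Rightarrow> real) \<Rightarrow> real \<times> real \<Rightarrow> real \<times> real" where
  "grad f z = (dx f z, dy f z)"

definition divergence :: "(real \<times> real \<Rightarrow> real \<times> real) \<Rightarrow> real \<times> real \<Rightarrow> real" where
  "divergence F z = dx (\<lambda>w. fst (F w)) z + dy (\<lambda>w. snd (F w)) z"

definition laplacian ::
    "(real \<times> real \<Rightarrow> 'b::real_normed_vector) \<Rightarrow> real \<times> real \<Rightarrow> 'b" where
  "laplacian f z = dx (dx f) z + dy (dy f) z"

definition advect ::
    "(real \<times> real \<Rightarrow> real \<times> real) \<Rightarrow> (real \<times> real \<Rightarrow> 'b::real_normed_vector)
      \<Rightarrow> real \<times> real \<Rightarrow> 'b" where
  "advect u f z = fst (u z) *\<^sub>R dx f z + snd (u z) *\<^sub>R dy f z"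

text \<open>Fields are written \<open>f t (x, y)\<close>, with \<open>t\<close> ranging over a time interval \<open>T\<close>.\<close>

definition dt ::
    "real set \<Rightarrow> (real \<Rightarrow> real \<times> real \<Rightarrow> 'b::real_normed_vector) \<Rightarrow> real \<Rightarrow> real \<times> real \<Rightarrow> 'b" where
  "dt T f t z = vector_derivative (\<lambda>s. f s z) (at t within T)"

definition admissible_field ::
    "real set \<Rightarrow> (real \<Rightarrow> real \<times> real \<Rightarrow> 'b::real_normed_vector) \<Rightarrow> bool" where
  "admissible_field T f \<longleftrightarrow>
     smooth_on (T \<times> closed_channel) (\<lambda>(t, z). f t z) \<and> (\<forall>t\<in>T. x_periodic (f t))"

definition pnp_ns_equations where
  "pnp_ns_equations (\<nu>::real) (Dp::real) (Dm::real) (lD::real) (\<gamma>::real) (E0::real) T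
      (u :: real \<Rightarrow> real \<times> real \<Rightarrow> real \<times> real) (p :: real \<Rightarrow> real \<times> real \<Rightarrow> real)
      (cp :: real \<Rightarrow> real \<times> real \<Rightarrow> real) (cm :: real \<Rightarrow> real \<times> real \<Rightarrow> real)
      (\<phi> :: real \<Rightarrow> real \<times> real \<Rightarrow> real) \<longleftrightarrow>
   (\<forall>t\<in>T. \<forall>z\<in>channel.
      let \<rho> = cp t z - cm t z in
      dt T u t z + advect (u t) (u t) z + grad (p t) z
        = \<nu> *\<^sub>R laplacian (u t) z + (\<gamma> * \<rho>) *\<^sub>R (E0 *\<^sub>R e1 - grad (\<phi> t) z) \<and>
      divergence (u t) z = 0 \<and>
      dt T cp t z + advect (u t) (cp t) z
        = Dp * divergence (\<lambda>w. grad (cp t) w + cp t w *\<^sub>R grad (\<phi> t) w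
                                - (E0 * cp t w) *\<^sub>R e1) z \<and>
      dt T cm t z + advect (u t) (cm t) z
        = Dm * divergence (\<lambda>w. grad (cm t) w - cm t w *\<^sub>R grad (\<phi> t) w
                                + (E0 * cm t w) *\<^sub>R e1) z \<and>
      - (lD\<^sup>2) * laplacian (\<phi> t) z = \<rho>)"

definition pnp_ns_boundary where
  "pnp_ns_boundary (Up::real) (Um::real) (\<zeta>p::real) (\<zeta>m::real) (c0::real) T
      (u :: real \<Rightarrow> real \<times> real \<Rightarrow> real \<times> real)
      (cp :: real \<Rightarrow> real \<times> real \<Rightarrow> real) (cm :: real \<Rightarrow> real \<times> real \<Rightarrow> real)
      (\<phi> :: real \<Rightarrow> real \<times> real \<Rightarrow> real) \<longleftrightarrow>
   (\<forall>t\<in>T. \<forall>x.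
      u t (x, 1) = (Up, 0) \<and> u t (x, -1) = (Um, 0) \<and>
      \<phi> t (x, 1) = \<zeta>p \<and> \<phi> t (x, -1) = \<zeta>m \<and>
      cp t (x, 1) = c0 * exp (- \<zeta>p) \<and> cp t (x, -1) = c0 * exp (- \<zeta>m) \<and>
      cm t (x, 1) = c0 * exp \<zeta>p \<and> cm t (x, -1) = c0 * exp \<zeta>m)"

definition pnp_ns_solution ::
    "real \<Rightarrow> real \<Rightarrow> real \<Rightarrow> real \<Rightarrow> real \<Rightarrow> real \<Rightarrow> real \<Rightarrow> real \<Rightarrow> real \<Rightarrow> real \<Rightarrow> real \<Rightarrow> real set
      \<Rightarrow> (real \<Rightarrow> real \<times> real \<Rightarrow> real \<times> real) \<Rightarrow> (real \<Rightarrow> real \<times> real \<Rightarrow> real) \<Rightarrow> (real \<Rightarrow> real \<times> real \<Rightarrow> real)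
      \<Rightarrow> (real \<Rightarrow> real \<times> real \<Rightarrow> real) \<Rightarrow> (real \<Rightarrow> real \<times> real \<Rightarrow> real) \<Rightarrow> bool" where
  "pnp_ns_solution \<nu> Dp Dm lD \<gamma> E0 Up Um \<zeta>p \<zeta>m c0 T u p cp cm \<phi> \<longleftrightarrow>
     admissible_field T u \<and> admissible_field T p \<and> admissible_field T cp \<and>
     admissible_field T cm \<and> admissible_field T \<phi> \<and>
     pnp_ns_equations \<nu> Dp Dm lD \<gamma> E0 T u p cp cm \<phi> \<and>
     pnp_ns_boundary Up Um \<zeta>p \<zeta>m c0 T u cp cm \<phi>"

definition pnp_ns_steady_state where
  "pnp_ns_steady_state \<nu> Dp Dm lD \<gamma> E0 Up Um \<zeta>p \<zeta>m c0 u p cp cm \<phi> \<longleftrightarrow>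
     pnp_ns_solution \<nu> Dp Dm lD \<gamma> E0 Up Um \<zeta>p \<zeta>m c0 UNIV
       (\<lambda>t. u) (\<lambda>t. p) (\<lambda>t. cp) (\<lambda>t. cm) (\<lambda>t. \<phi>)"

text \<open>Smooth solutions of the Poisson--Boltzmann problem: smooth in the open interval and
  continuous on the closed one.  Values outside \<open>[-1,1]\<close> are irrelevant, so such solutions are
  to be compared on \<open>[-1,1]\<close> only.\<close>

definition poisson_boltzmann ::
    "real \<Rightarrow> real \<Rightarrow> real \<Rightarrow> real \<Rightarrow> (real \<Rightarrow> real) \<Rightarrow> bool" where
  "poisson_boltzmann lD c0 \<zeta>p \<zeta>m \<phi> \<longleftrightarrow>
     smooth_on {-1<..<1} \<phi> \<and> continuous_on {-1..1} \<phi> \<and>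
     (\<forall>y\<in>{-1<..<1}.
        - (lD\<^sup>2) * deriv (deriv \<phi>) y = c0 * exp (- \<phi> y) - c0 * exp (\<phi> y)) \<and>
     \<phi> 1 = \<zeta>p \<and> \<phi> (-1) = \<zeta>m"

definition couette :: "real \<Rightarrow> real \<Rightarrow> real \<Rightarrow> real" where
  "couette Up Um y = (Up - Um) / 2 * y + (Up + Um) / 2"

definition ell :: "real \<Rightarrow> real \<Rightarrow> real \<Rightarrow> real" where
  "ell \<zeta>p \<zeta>m y = (1 + y) / 2 * \<zeta>p + (1 - y) / 2 * \<zeta>m"

end

theory Submission
  imports Defs
begin

text \<open>
  Since \<open>c0 exp (-\<phi>) - c0 exp \<phi> = - 2 c0 sinh \<phi>\<close>, the Poisson--Boltzmann problem is
  \<open>\<phi>'' = k sinh \<phi>\<close> with \<open>k = 2 c0 / lD\<^sup>2 > 0\<close> and prescribed values at \<open>\<plusminus>1\<close>.  The right-hand side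
  is strictly increasing in \<open>\<phi>\<close>, so the difference of two solutions is strictly convex wherever
  it is positive and cannot have a positive interior maximum: this maximum principle
  (\<open>weak_maximum_principle\<close>) gives uniqueness.

  For existence, \<open>sinh\<close> is first frozen outside an interval \<open>[-M, M]\<close> containing the boundary
  values in its interior, which makes the nonlinearity \<open>g\<close> nondecreasing and \<open>K\<close>-Lipschitz for some
  \<open>K\<close>.  Writing the equation as \<open>- w'' + K w = K w - g w\<close> exhibits \<open>w\<close> as a fixed point: the
  map \<open>x \<mapsto> K x - g x\<close> is \<open>K\<close>-Lipschitz precisely because \<open>g\<close> is monotone, and the solution
  operator of \<open>- w'' + K w = f\<close> has supremum norm at most \<open>(1 - 1 / cosh (sqrt K)) / K\<close>, again by
  the maximum principle.  The composition is therefore a contraction for the supremum norm,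
  whatever the size of the data (\<open>monotone_lipschitz_dirichlet\<close>).  A last use of the maximum
  principle shows that the fixed point stays in \<open>[-M, M]\<close>, so that the truncation is invisible
  (\<open>sinh_dirichlet_solvable\<close>).

  Smoothness up to the boundary is algebraic: the algebra of functions of \<open>y\<close> generated by constants, \<open>y\<close>, \<open>\<phi>\<close>, \<open>\<phi>'\<close> and \<open>exp (\<plusminus>\<phi>)\<close> is closed
  under differentiation, because the equation expresses \<open>\<phi>''\<close> in the same algebra.  All members of
  such an algebra are smooth by coinduction (\<open>smooth_on_pullback\<close>), and all fields of the steady
  state have their profiles in it.

  Finally, the equations hold for three reasons.  All fields depend on \<open>y\<close> only and the flow is
  horizontal, so time derivatives and advection vanish.  The Boltzmann
  relation makes the vertical ionic fluxes vanish and balances the vertical electric force by the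
  osmotic pressure \<open>\<gamma> (c\<^sub>+ + c\<^sub>-)\<close>.  Along the channel, the viscous force \<open>\<nu> U'' = \<gamma> lD\<^sup>2 E0 \<phi>''\<close>
  cancels the driving force \<open>\<gamma> \<rho> E0\<close> by the Poisson equation
  (\<open>sheared_boltzmann_equilibrium\<close>).
\<close>

section \<open>Two-point boundary value problems and the maximum principle\<close>

text \<open>
  At an interior maximum \<open>m\<close> with \<open>v m > 0\<close> the first derivative vanishes and the second is
  positive, so \<open>v'\<close> is positive just to the right of \<open>m\<close> and \<open>v\<close> exceeds its maximum there.
  The convexity hypothesis is imposed only where \<open>v\<close> is positive, which is what allows the lemma to
  be applied to differences of solutions of monotone equations.
\<close>

lemma weak_maximum_principle:
  fixes v v' v'' :: "real \<Rightarrow> real"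
  assumes cont: "continuous_on {a..b} v"
    and v': "\<And>y. y \<in> {a<..<b} \<Longrightarrow> (v has_real_derivative v' y) (at y)"
    and v'': "\<And>y. y \<in> {a<..<b} \<Longrightarrow> (v' has_real_derivative v'' y) (at y)"
    and convex: "\<And>y. y \<in> {a<..<b} \<Longrightarrow> v y > 0 \<Longrightarrow> v'' y > 0"
    and boundary: "v a \<le> 0" "v b \<le> 0"
    and y: "y \<in> {a..b}"
  shows "v y \<le> 0"
proof (rule ccontr)
  assume "\<not> v y \<le> 0"
  moreover obtain m where m: "m \<in> {a..b}" and max: "\<And>z. z \<in> {a..b} \<Longrightarrow> v z \<le> v m"
    using continuous_attains_sup[OF compact_Icc _ cont] y by blast
  ultimately have pos: "v m > 0"
    using y by force
  then have "m \<noteq> a" "m \<noteq> b"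
    using boundary by auto
  with m have inner: "m \<in> {a<..<b}"
    by auto
  have "v' m = 0"
    by (rule DERIV_local_max[OF v'[OF inner], of "min (m - a) (b - m)"])
      (use inner max in \<open>auto simp: abs_less_iff\<close>)
  moreover obtain d where "d > 0" and d: "\<And>h. 0 < h \<Longrightarrow> h < d \<Longrightarrow> v' m < v' (m + h)"
    using DERIV_pos_inc_right[OF v''[OF inner] convex[OF inner pos]] by blast
  moreover define h where "h = min d (b - m) / 2"
  ultimately have h: "h > 0" "h < d" "m + h < b"
    and rising: "\<And>k. 0 < k \<Longrightarrow> k < d \<Longrightarrow> v' (m + k) > 0"
    using inner by (simp_all add: min_def) (simp_all add: field_simps split: if_splits)
  have "\<exists>z>m. z < m + h \<and> v (m + h) - v m = (m + h - m) * v' z"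
    by (rule MVT2) (use h inner v' in auto)
  then obtain z where z: "m < z" "z < m + h" "v (m + h) - v m = h * v' z"
    by auto
  have "v' z > 0"
    using rising[of "z - m"] z h by simp
  then have "v (m + h) > v m"
    using z h by (smt (verit) mult_pos_pos)
  then show False
    using max[of "m + h"] h inner by auto
qed

text \<open>
  The right-hand side is a function of the position only; a nonlinear equation \<open>w'' = g w\<close> is
  expressed by letting \<open>f\<close> depend on \<open>w\<close>.  Derivatives at the endpoints are one-sided, so that
  regularity up to the boundary is part of the notion.
\<close>

definition solves_dirichlet ::
    "real \<Rightarrow> real \<Rightarrow> (real \<Rightarrow> real) \<Rightarrow> (real \<Rightarrow> real) \<Rightarrow> (real \<Rightarrow> real) \<Rightarrow> bool" where
  "solves_dirichlet a b f w w' \<longleftrightarrow>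
     (\<forall>y\<in>{-1..1}. (w has_real_derivative w' y) (at y within {-1..1}) \<and>
                   (w' has_real_derivative f y) (at y within {-1..1})) \<and>
     w (-1) = a \<and> w 1 = b"

lemma solves_dirichlet_continuous_on:
  assumes "solves_dirichlet a b f w w'"
  shows "continuous_on {-1..1} w"
  using assms unfolding solves_dirichlet_def
  by (meson DERIV_continuous_on)

lemma solves_dirichlet_interior:
  assumes "solves_dirichlet a b f w w'" "y \<in> {-1<..<1}"
  shows "(w has_real_derivative w' y) (at y)" "(w' has_real_derivative f y) (at y)"
proof -
  have "at y within {-1..1} = at y"
    by (rule at_within_interior) (use assms(2) in auto)
  then show "(w has_real_derivative w' y) (at y)" "(w' has_real_derivative f y) (at y)"
    using assms unfolding solves_dirichlet_def
    by (metis atLeastAtMost_iff greaterThanLessThan_iff less_imp_le)+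
qed

text \<open>
  Variation of constants: \<open>w0 y = - (1 / \<kappa>) \<integral> sinh (\<kappa> (y - s)) f s ds\<close>, integrated from \<open>-1\<close> to
  \<open>y\<close>, is a particular solution vanishing at \<open>-1\<close>, and multiples of \<open>sinh (\<kappa> (1 \<mp> y))\<close> correct
  the two boundary values independently.  Splitting \<open>sinh\<close> into exponentials separates \<open>y\<close> from
  \<open>s\<close> and reduces differentiation of the integral to the fundamental theorem of calculus.
\<close>

lemma linear_dirichlet_solvable:
  fixes \<kappa> a b :: real
  assumes \<kappa>: "\<kappa> > 0" and f: "continuous_on {-1..1} f"
  shows "\<exists>w w'. solves_dirichlet a b (\<lambda>y. \<kappa>\<^sup>2 * w y - f y) w w'"
proof -
  define F G where "F = (\<lambda>y. integral {-1..y} (\<lambda>s. exp (- \<kappa> * s) * f s))"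
    and "G = (\<lambda>y. integral {-1..y} (\<lambda>s. exp (\<kappa> * s) * f s))"
  define w0 w0' where "w0 = (\<lambda>y. (exp (- \<kappa> * y) * G y - exp (\<kappa> * y) * F y) / (2 * \<kappa>))"
    and "w0' = (\<lambda>y. - (exp (- \<kappa> * y) * G y + exp (\<kappa> * y) * F y) / 2)"
  define \<alpha> \<beta> where "\<alpha> = a / sinh (\<kappa> * 2)" and "\<beta> = (b - w0 1) / sinh (\<kappa> * 2)"
  define w w' where "w = (\<lambda>y. w0 y + \<alpha> * sinh (\<kappa> * (1 - y)) + \<beta> * sinh (\<kappa> * (1 + y)))"
    and "w' = (\<lambda>y. w0' y - \<alpha> * \<kappa> * cosh (\<kappa> * (1 - y)) + \<beta> * \<kappa> * cosh (\<kappa> * (1 + y)))"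
  have F: "(F has_real_derivative exp (- \<kappa> * y) * f y) (at y within {-1..1})"
    and G: "(G has_real_derivative exp (\<kappa> * y) * f y) (at y within {-1..1})"
    if "y \<in> {-1..1}" for y
    unfolding F_def G_def
    by (rule integral_has_real_derivative; intro continuous_intros f that)+
  have "(w has_real_derivative w' y) (at y within {-1..1})"
    and "(w' has_real_derivative \<kappa>\<^sup>2 * w y - f y) (at y within {-1..1})"
    if "y \<in> {-1..1}" for y
  proof -
    define E N where "E = (\<lambda>y. exp (\<kappa> * y))" and "N = (\<lambda>y. exp (- \<kappa> * y))"
    have EN: "E y * N y = 1"
      by (simp add: E_def N_def flip: exp_add)
    have E: "(E has_real_derivative \<kappa> * E y) (at y within {-1..1})"
      and N: "(N has_real_derivative - \<kappa> * N y) (at y within {-1..1})"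
      unfolding E_def N_def by (auto intro!: derivative_eq_intros)
    have derivs: "(F has_real_derivative N y * f y) (at y within {-1..1})"
        "(G has_real_derivative E y * f y) (at y within {-1..1})"
      using F[OF that] G[OF that] by (simp_all add: E_def N_def)
    have w0: "w0 = (\<lambda>y. (N y * G y - E y * F y) / (2 * \<kappa>))"
      and w0': "w0' = (\<lambda>y. - (N y * G y + E y * F y) / 2)"
      by (simp_all add: w0_def w0'_def E_def N_def)
    have "((\<lambda>y. N y * G y - E y * F y) has_real_derivative 2 * \<kappa> * w0' y) (at y within {-1..1})"
      unfolding w0'
      by (rule derivative_eq_intros E N derivs refl)+ (simp add: algebra_simps)
    from DERIV_cdivide[OF this, of "2 * \<kappa>"]
    have "(w0 has_real_derivative w0' y) (at y within {-1..1})"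
      using \<kappa> by (simp add: w0)
    then show "(w has_real_derivative w' y) (at y within {-1..1})"
      unfolding w_def w'_def by (auto intro!: derivative_eq_intros)
    have "((\<lambda>y. - (N y * G y + E y * F y)) has_real_derivative
        \<kappa> * (N y * G y - E y * F y) - 2 * (E y * N y) * f y) (at y within {-1..1})"
      by (rule derivative_eq_intros E N derivs refl)+ (simp add: algebra_simps)
    also have "\<kappa> * (N y * G y - E y * F y) - 2 * (E y * N y) * f y = 2 * (\<kappa>\<^sup>2 * w0 y - f y)"
      using \<kappa> by (simp add: EN w0 power2_eq_square)
    finally have "(w0' has_real_derivative 2 * (\<kappa>\<^sup>2 * w0 y - f y) / 2) (at y within {-1..1})"
      unfolding w0' by (rule DERIV_cdivide)
    then have "(w0' has_real_derivative \<kappa>\<^sup>2 * w0 y - f y) (at y within {-1..1})"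
      by (simp add: diff_divide_distrib)
    then show "(w' has_real_derivative \<kappa>\<^sup>2 * w y - f y) (at y within {-1..1})"
      unfolding w_def w'_def
      by (auto intro!: derivative_eq_intros simp: algebra_simps power2_eq_square)
  qed
  moreover have "w (-1) = a" "w 1 = b"
    using \<kappa> by (simp_all add: w_def w0_def F_def G_def \<alpha>_def \<beta>_def)
  ultimately show ?thesis
    unfolding solves_dirichlet_def by blast
qed

text \<open>
  This bounds the solution operator of \<open>- w'' + \<kappa>\<^sup>2 w = f\<close> in the supremum norm.  The barrier
  \<open>\<delta> (1 - cosh (\<kappa> y) / cosh \<kappa>)\<close> solves the equation with right-hand side \<open>\<kappa>\<^sup>2 \<delta>\<close> and
  homogeneous boundary data, and therefore dominates \<open>w - z\<close>; its largest value is attained at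
  \<open>y = 0\<close>.  That this value is strictly smaller than \<open>\<delta>\<close> is the source of the
  contraction below.
\<close>

lemma linear_dirichlet_comparison:
  assumes \<kappa>: "\<kappa> > 0"
    and w: "solves_dirichlet a b (\<lambda>y. \<kappa>\<^sup>2 * w y - f y) w w'"
    and z: "solves_dirichlet a b (\<lambda>y. \<kappa>\<^sup>2 * z y - g y) z z'"
    and fg: "\<And>y. y \<in> {-1..1} \<Longrightarrow> f y - g y \<le> \<kappa>\<^sup>2 * \<delta>" and "\<delta> \<ge> 0"
    and y: "y \<in> {-1..1}"
  shows "w y - z y \<le> (1 - 1 / cosh \<kappa>) * \<delta>"
proof -
  define c where "c = \<delta> / cosh \<kappa>"
  \<comment> \<open>\<open>w - z\<close> minus the barrier; it is nonpositive at \<open>\<plusminus>1\<close> because the barrier vanishes there\<close>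
  define v where "v = (\<lambda>y. w y - z y - \<delta> + c * cosh (\<kappa> * y))"
  define v' where "v' = (\<lambda>y. w' y - z' y + c * \<kappa> * sinh (\<kappa> * y))"
  have c: "c \<ge> 0" "c \<le> c * cosh (\<kappa> * y)"
    using \<open>\<delta> \<ge> 0\<close> cosh_real_ge_1 by (auto simp: c_def intro: mult_left_mono[where c=c and a=1, simplified])
  have "v y \<le> 0"
  proof (rule weak_maximum_principle[of "-1" 1 v v'
        "\<lambda>y. (\<kappa>\<^sup>2 * w y - f y) - (\<kappa>\<^sup>2 * z y - g y) + c * \<kappa>\<^sup>2 * cosh (\<kappa> * y)"])
    show "continuous_on {-1..1} v"
      unfolding v_def using w z
      by (intro continuous_intros) (auto dest: solves_dirichlet_continuous_on)
    show "(v has_real_derivative v' y) (at y)" if "y \<in> {-1<..<1}" for y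
      unfolding v_def v'_def
      by (rule derivative_eq_intros solves_dirichlet_interior[OF w that]
          solves_dirichlet_interior[OF z that] refl | simp)+
    show "(v' has_real_derivative
        (\<kappa>\<^sup>2 * w y - f y) - (\<kappa>\<^sup>2 * z y - g y) + c * \<kappa>\<^sup>2 * cosh (\<kappa> * y)) (at y)"
      if "y \<in> {-1<..<1}" for y
      unfolding v_def v'_def
      by (rule derivative_eq_intros solves_dirichlet_interior[OF w that]
          solves_dirichlet_interior[OF z that] refl | simp add: power2_eq_square)+
    show "(\<kappa>\<^sup>2 * w y - f y) - (\<kappa>\<^sup>2 * z y - g y) + c * \<kappa>\<^sup>2 * cosh (\<kappa> * y) > 0"
      if "y \<in> {-1<..<1}" "v y > 0" for y
    proof -
      have "0 < \<kappa>\<^sup>2 * v y"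
        using that \<kappa> by simp
      then show ?thesis
        using fg[of y] that by (simp add: v_def algebra_simps)
    qed
  qed (use w z y in \<open>auto simp: v_def c_def solves_dirichlet_def\<close>)
  then show ?thesis
    using c by (simp add: v_def c_def algebra_simps)
qed

text \<open>
  Shifting by \<open>K\<close> turns monotonicity into contractivity: the equation becomes
  \<open>- w'' + K w = K w - g w\<close>, the right-hand side is \<open>K\<close>-Lipschitz in \<open>w\<close> since
  \<open>0 \<le> g y - g x \<le> K (y - x)\<close> for \<open>x \<le> y\<close>, and solving the linear problem gains a factor
  \<open>(1 - 1 / cosh (sqrt K)) / K\<close>.
\<close>

lemma monotone_lipschitz_dirichlet:
  fixes g :: "real \<Rightarrow> real"
  assumes "mono g" and K: "K > 0" "\<And>x y. x \<le> y \<Longrightarrow> g y - g x \<le> K * (y - x)"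
  shows "\<exists>w w'. solves_dirichlet a b (\<lambda>y. g (w y)) w w'"
proof -
  define \<kappa> where "\<kappa> = sqrt K"
  have \<kappa>: "\<kappa> > 0" "\<kappa>\<^sup>2 = K"
    using K by (simp_all add: \<kappa>_def)
  have close: "\<bar>(K * x - g x) - (K * y - g y)\<bar> \<le> K * \<bar>x - y\<bar>" for x y
  proof (induction x y rule: linorder_wlog)
    case (le x y)
    then show ?case
      using K(2)[of x y] monoD[OF \<open>mono g\<close>, of x y] by (simp add: abs_if algebra_simps)
  qed (simp add: abs_minus_commute)
  have lip: "K-lipschitz_on UNIV g"
  proof (rule lipschitz_onI)
    show "dist (g x) (g y) \<le> K * dist x y" for x y
    proof (induction x y rule: linorder_wlog)
      case (le x y)
      then show ?case
        using K(2)[of x y] monoD[OF \<open>mono g\<close>, of x y] by (simp add: dist_real_def)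
    qed (simp add: dist_commute)
  qed (use K in simp)
  have source: "continuous_on {-1..1} (\<lambda>y. K * apply_bcontfun u y - g (apply_bcontfun u y))" for u
    using continuous_on_compose2[OF lipschitz_on_continuous_on[OF lip]]
    by (intro continuous_intros) auto
  define S where "S = (\<lambda>(u :: real \<Rightarrow>\<^sub>C real) w. solves_dirichlet a b
      (\<lambda>y. K * w y - (K * apply_bcontfun u y - g (apply_bcontfun u y))) w)"
  have "\<exists>w w'. S u w w'" for u
    using linear_dirichlet_solvable[OF \<kappa>(1) source] unfolding S_def \<kappa> by blast
  then obtain W W' where "S u (W u) (W' u)" for u
    by metis
  then have W: "solves_dirichlet a b
      (\<lambda>y. K * W u y - (K * apply_bcontfun u y - g (apply_bcontfun u y))) (W u) (W' u)" for u
    unfolding S_def by blast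
  \<comment> \<open>Solutions are transported to bounded continuous functions on the whole line by constant
    continuation beyond the endpoints, in order to work in a Banach space.\<close>
  define T where "T = (\<lambda>u. Bcontfun (\<lambda>x. W u (clamp (-1) 1 x)))"
  have T: "apply_bcontfun (T u) x = W u (clamp (-1) 1 x)" for u x
  proof -
    have cont: "continuous_on (cbox (-1) 1) (W u)"
      using solves_dirichlet_continuous_on[OF W] by (simp add: box_real)
    have "(\<lambda>x. W u (clamp (-1) 1 x)) \<in> bcontfun"
      unfolding bcontfun_def
      using clamp_continuous_on[OF cont]
        clamp_bounded[OF compact_imp_bounded[OF compact_continuous_image[OF cont compact_cbox]]]
      by simp
    then show ?thesis
      by (simp add: T_def Bcontfun_inverse)
  qed
  define q where "q = 1 - 1 / cosh \<kappa>"
  have q: "0 \<le> q" "q < 1"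
    using cosh_real_ge_1[of \<kappa>] by (simp_all add: q_def)
  have one_sided: "W u y - W v y \<le> q * dist u v" if "y \<in> {-1..1}" for u v y
    unfolding q_def
  proof (rule linear_dirichlet_comparison[OF \<kappa>(1) W[of u, folded \<kappa>(2)] W[of v, folded \<kappa>(2)] _ _ that])
    fix s
    have "(K * u s - g (u s)) - (K * v s - g (v s)) \<le> K * \<bar>u s - v s\<bar>"
      using close[of "u s" "v s"] by linarith
    also have "\<dots> \<le> K * dist u v"
      using dist_bounded[of u s v] K by (simp add: dist_real_def)
    finally show "\<kappa>\<^sup>2 * u s - g (u s) - (\<kappa>\<^sup>2 * v s - g (v s)) \<le> \<kappa>\<^sup>2 * dist u v"
      by (simp add: \<kappa>)
  qed simp
  have "dist (T u) (T v) \<le> q * dist u v" for u v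
  proof (rule dist_bound)
    fix x
    have "clamp (-1) 1 x \<in> {-1..1::real}"
      using clamp_in_interval[of "-1" 1 x] by (simp add: box_real)
    from one_sided[OF this, of u v] one_sided[OF this, of v u]
    show "dist (T u x) (T v x) \<le> q * dist u v"
      by (simp add: T dist_real_def abs_le_iff dist_commute)
  qed
  with q banach_fix_type obtain u where u: "T u = u"
    by metis
  have "apply_bcontfun u y = W u y" if "y \<in> {-1..1}" for y
    using T[of u y] that unfolding u by (simp add: box_real)
  then have "solves_dirichlet a b (\<lambda>y. g (W u y)) (W u) (W' u)"
    using W[of u] unfolding solves_dirichlet_def by simp
  then show ?thesis by blast
qed

text \<open>
  The equation is solved with \<open>sinh\<close> frozen outside \<open>[-M, M]\<close>.  Where \<open>w > M\<close> the solution has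
  second derivative \<open>k sinh M > 0\<close>, so the maximum principle applied to \<open>w - M\<close> excludes such
  points; the lower bound is symmetric.
\<close>

lemma sinh_dirichlet_solvable:
  fixes k a b :: real
  assumes k: "k > 0"
  shows "\<exists>w w'. solves_dirichlet a b (\<lambda>y. k * sinh (w y)) w w'"
proof -
  \<comment> \<open>The summand 1 only ensures that \<open>M\<close>, and hence sinh \<open>M\<close>, is positive when \<open>a = b = 0\<close>.\<close>
  define M where "M = \<bar>a\<bar> + \<bar>b\<bar> + 1"
  have M: "M > 0" "\<bar>a\<bar> < M" "\<bar>b\<bar> < M"
    by (simp_all add: M_def)
  define c where "c = (\<lambda>x. max (- M) (min M x))"
  define g where "g = (\<lambda>x. k * sinh (c x))"
  have "mono g"
    unfolding g_def c_def using k by (intro monoI mult_left_mono) auto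
  moreover have "g y - g x \<le> k * cosh M * (y - x)" if "x \<le> y" for x y
  proof -
    have c: "- M \<le> c x" "c x \<le> c y" "c y \<le> M" "c y - c x \<le> y - x"
      using that M by (auto simp: c_def)
    have "sinh (c y) - sinh (c x) \<le> cosh M * (c y - c x)"
    proof (cases "c x = c y")
      case False
      have "\<exists>z>c x. z < c y \<and> sinh (c y) - sinh (c x) = (c y - c x) * cosh z"
        by (rule MVT2) (use c False in \<open>auto intro!: derivative_eq_intros\<close>)
      then obtain z where z: "c x < z" "z < c y" "sinh (c y) - sinh (c x) = (c y - c x) * cosh z"
        by blast
      have "cosh \<bar>z\<bar> \<le> cosh M"
        using z c M by (subst cosh_real_nonneg_le_iff) auto
      then show ?thesis
        using z c by (simp add: mult.commute mult_left_mono)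
    qed simp
    also have "\<dots> \<le> cosh M * (y - x)"
      using c by simp
    finally have "k * (sinh (c y) - sinh (c x)) \<le> k * (cosh M * (y - x))"
      using k by simp
    then show ?thesis
      by (simp add: g_def right_diff_distrib mult.assoc)
  qed
  moreover have "k * cosh M > 0"
    using k by simp
  ultimately obtain w w' where w: "solves_dirichlet a b (\<lambda>y. g (w y)) w w'"
    using monotone_lipschitz_dirichlet by blast
  have sinh_M: "sinh M > 0"
    using M by simp
  have cont: "continuous_on {-1..1} w"
    by (rule solves_dirichlet_continuous_on[OF w])
  note w_interior = solves_dirichlet_interior[OF w]
  have boundary: "w (-1) = a" "w 1 = b"
    using w by (simp_all add: solves_dirichlet_def)
  have "w y - M \<le> 0" if "y \<in> {-1..1}" for y
  proof (rule weak_maximum_principle[of "-1" 1 "\<lambda>y. w y - M" w' "\<lambda>y. g (w y)"])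
    show "((\<lambda>y. w y - M) has_real_derivative w' y) (at y)" if "y \<in> {-1<..<1}" for y
      using DERIV_diff[OF w_interior(1)[OF that] DERIV_const] by simp
    show "0 < g (w y)" if "0 < w y - M" for y
      using that k M sinh_M by (simp add: g_def c_def)
  qed (use cont boundary M that w_interior in \<open>auto intro: continuous_on_diff continuous_on_const\<close>)
  moreover have "- w y - M \<le> 0" if "y \<in> {-1..1}" for y
  proof (rule weak_maximum_principle[of "-1" 1 "\<lambda>y. - w y - M" "\<lambda>y. - w' y" "\<lambda>y. - g (w y)"])
    show "((\<lambda>y. - w y - M) has_real_derivative - w' y) (at y)" if "y \<in> {-1<..<1}" for y
      using DERIV_diff[OF DERIV_minus[OF w_interior(1)[OF that]] DERIV_const] by simp
    show "0 < - g (w y)" if "0 < - w y - M" for y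
      using that k M sinh_M by (simp add: g_def c_def)
  qed (use cont boundary M that w_interior in
      \<open>auto intro: continuous_on_diff continuous_on_minus continuous_on_const DERIV_minus\<close>)
  ultimately have "g (w y) = k * sinh (w y)" if "y \<in> {-1..1}" for y
    using that by (fastforce simp: g_def c_def)
  then have "solves_dirichlet a b (\<lambda>y. k * sinh (w y)) w w'"
    using w unfolding solves_dirichlet_def by simp
  then show ?thesis by blast
qed

section \<open>Smoothness from algebras closed under differentiation\<close>

text \<open>
  The coinduction invariant consists of all functions \<open>z \<mapsto> f (l z) v\<close> with \<open>f\<close> in the class and
  \<open>v\<close> an arbitrary vector: a directional derivative has the form \<open>f' (l z) (l h v)\<close>, which
  is again of this form with another vector.  The linear map \<open>l\<close> serves to treat functions of one
  variable, and fields on space-time that depend on one coordinate, by the same argument.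
\<close>

lemma smooth_on_pullback:
  fixes l :: "'a::euclidean_space \<Rightarrow> real" and v :: "'b::real_normed_vector"
  assumes closed: "\<And>f. f \<in> C \<Longrightarrow> \<exists>f'\<in>C. \<forall>y\<in>I. (f has_real_derivative f' y) (at y within I)"
    and f: "f \<in> C" and l: "bounded_linear l" "l ` S \<subseteq> I"
  shows "smooth_on S (\<lambda>z. f (l z) *\<^sub>R v)"
proof -
  define X where "X = (\<lambda>F :: 'a \<Rightarrow> 'b. \<exists>f\<in>C. \<exists>v. F = (\<lambda>z. f (l z) *\<^sub>R v))"
  have "X (\<lambda>z. f (l z) *\<^sub>R v)"
    using f by (auto simp: X_def)
  then show ?thesis
  proof (coinduct rule: smooth_on.coinduct)
    case (smooth_on F)
    then obtain f v where f: "f \<in> C" and F: "F = (\<lambda>z. f (l z) *\<^sub>R v)"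
      unfolding X_def by blast
    obtain f' where f': "f' \<in> C" and deriv: "\<And>y. y \<in> I \<Longrightarrow> (f has_real_derivative f' y) (at y within I)"
      using closed[OF f] by blast
    have "(F has_derivative (\<lambda>h. f' (l z) *\<^sub>R (l h *\<^sub>R v))) (at z within S)" if "z \<in> S" for z
    proof -
      have "(f has_derivative (\<lambda>h. f' (l z) * h)) (at (l z) within l ` S)"
        using deriv[of "l z"] l(2) that
        by (auto simp: has_field_derivative_def intro: has_derivative_subset)
      then have "((\<lambda>z. f (l z)) has_derivative (\<lambda>h. f' (l z) * l h)) (at z within S)"
        using has_derivative_in_compose bounded_linear.has_derivative[OF l(1) has_derivative_ident]
        by blast
      from has_derivative_scaleR_left[OF this, of v] show ?thesis
        by (simp add: F)
    qed
    moreover have "X (\<lambda>z. f' (l z) *\<^sub>R (l h *\<^sub>R v))" for h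
      unfolding X_def using f' by blast
    ultimately show ?case
      by (intro exI[of _ F] exI[of _ "\<lambda>z h. f' (l z) *\<^sub>R (l h *\<^sub>R v)"]) auto
  qed
qed

inductive_set generated_algebra :: "(real \<Rightarrow> real) set \<Rightarrow> (real \<Rightarrow> real) set" for G where
  generator: "f \<in> G \<Longrightarrow> f \<in> generated_algebra G"
| const: "(\<lambda>_. c) \<in> generated_algebra G"
| add: "f \<in> generated_algebra G \<Longrightarrow> g \<in> generated_algebra G \<Longrightarrow> (\<lambda>y. f y + g y) \<in> generated_algebra G"
| mult: "f \<in> generated_algebra G \<Longrightarrow> g \<in> generated_algebra G \<Longrightarrow> (\<lambda>y. f y * g y) \<in> generated_algebra G"

text \<open>
  By the sum and product rules, closure under differentiation needs to be checked on generators
  only.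
\<close>

lemma generated_algebra_derivative:
  assumes G: "\<And>f. f \<in> G \<Longrightarrow>
      \<exists>f'\<in>generated_algebra G. \<forall>y\<in>I. (f has_real_derivative f' y) (at y within I)"
    and f: "f \<in> generated_algebra G"
  shows "\<exists>f'\<in>generated_algebra G. \<forall>y\<in>I. (f has_real_derivative f' y) (at y within I)"
  using f
proof induction
  case (generator f)
  then show ?case by (rule G)
next
  case (const c)
  show ?case
    by (rule bexI[OF _ generated_algebra.const[of 0]]) simp
next
  case (add f g)
  then obtain f' g' where mem: "f' \<in> generated_algebra G" "g' \<in> generated_algebra G"
    and deriv: "\<And>y. y \<in> I \<Longrightarrow> (f has_real_derivative f' y) (at y within I)"
      "\<And>y. y \<in> I \<Longrightarrow> (g has_real_derivative g' y) (at y within I)"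
    by blast
  have "(\<lambda>y. f' y + g' y) \<in> generated_algebra G"
    by (intro generated_algebra.add generated_algebra.mult mem add.hyps)
  then show ?case
    by (rule bexI[rotated]) (intro ballI DERIV_add deriv)
next
  case (mult f g)
  then obtain f' g' where mem: "f' \<in> generated_algebra G" "g' \<in> generated_algebra G"
    and deriv: "\<And>y. y \<in> I \<Longrightarrow> (f has_real_derivative f' y) (at y within I)"
      "\<And>y. y \<in> I \<Longrightarrow> (g has_real_derivative g' y) (at y within I)"
    by blast
  have "(\<lambda>y. f' y * g y + g' y * f y) \<in> generated_algebra G"
    by (intro generated_algebra.add generated_algebra.mult mem mult.hyps)
  then show ?case
    by (rule bexI[rotated]) (intro ballI DERIV_mult deriv)
qed

lemma smooth_on_real_derivative:
  fixes f :: "real \<Rightarrow> real"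
  assumes "smooth_on S f" "open S"
  shows "\<exists>f'. smooth_on S f' \<and> (\<forall>y\<in>S. (f has_real_derivative f' y) (at y))"
proof -
  obtain f' where f': "\<And>z. z \<in> S \<Longrightarrow> (f has_derivative f' z) (at z within S)"
      "\<And>v. smooth_on S (\<lambda>z. f' z v)"
    using assms(1)[unfolded smooth_on.simps[of S f]] by blast
  have "(f has_real_derivative f' y 1) (at y)" if "y \<in> S" for y
  proof -
    have D: "(f has_derivative f' y) (at y)"
      using f'(1)[OF that] unfolding at_within_open[OF that assms(2)] .
    have "f' y h = f' y 1 * h" for h
      using linear_cmul[OF has_derivative_linear[OF D], of h 1] by simp
    then have "f' y = (*) (f' y 1)"
      by (rule ext)
    then show ?thesis
      using D by (simp add: has_field_derivative_def)
  qed
  then show ?thesis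
    using f'(2) by blast
qed

section \<open>Fields on the channel depending on the transverse coordinate\<close>

lemma open_channel: "open channel"
  unfolding channel_def by (intro open_Times) auto

text \<open>
  The field is described on the open channel only, because this is all that is known about a
  derivative such as \<open>dx F\<close>; the rule can then be applied again to obtain second
  derivatives.
\<close>

lemma shear_derivatives:
  fixes F :: "real \<times> real \<Rightarrow> 'b::real_normed_vector"
  assumes F: "\<And>w. w \<in> channel \<Longrightarrow> F w = f (snd w) *\<^sub>R v"
    and f': "\<And>y. y \<in> {-1<..<1} \<Longrightarrow> (f has_real_derivative f' y) (at y)"
    and z: "z \<in> channel"
  shows "dx F z = 0" "dy F z = f' (snd z) *\<^sub>R v"
proof -
  have y: "snd z \<in> {-1<..<1}"
    using z by (auto simp: channel_def)
  have "(f has_derivative (\<lambda>h. f' (snd z) * h)) (at (snd z))"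
    using f'[OF y] by (simp add: has_field_derivative_def)
  from has_derivative_compose[OF has_derivative_snd[OF has_derivative_ident] this]
  have "((\<lambda>w. f (snd w)) has_derivative (\<lambda>h. f' (snd z) * snd h)) (at z)" .
  then have "((\<lambda>w. f (snd w) *\<^sub>R v) has_derivative (\<lambda>h. (f' (snd z) * snd h) *\<^sub>R v)) (at z)"
    by (rule has_derivative_scaleR_left)
  then have "(F has_derivative (\<lambda>h. (f' (snd z) * snd h) *\<^sub>R v)) (at z)"
    by (rule has_derivative_transform_within_open[OF _ open_channel z]) (simp add: F)
  from frechet_derivative_at[OF this]
  have "frechet_derivative F (at z) = (\<lambda>h. (f' (snd z) * snd h) *\<^sub>R v)"
    by simp
  then show "dx F z = 0" "dy F z = f' (snd z) *\<^sub>R v"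
    by (simp_all add: dx_def dy_def)
qed

lemma shear_laplacian:
  fixes F :: "real \<times> real \<Rightarrow> 'b::real_normed_vector"
  assumes F: "\<And>w. w \<in> channel \<Longrightarrow> F w = f (snd w) *\<^sub>R v"
    and f': "\<And>y. y \<in> {-1<..<1} \<Longrightarrow> (f has_real_derivative f' y) (at y)"
    and f'': "\<And>y. y \<in> {-1<..<1} \<Longrightarrow> (f' has_real_derivative f'' y) (at y)"
    and z: "z \<in> channel"
  shows "laplacian F z = f'' (snd z) *\<^sub>R v"
proof -
  have "dx (dx F) z = 0"
    by (rule shear_derivatives(1)[of _ "\<lambda>_. 0" v "\<lambda>_. 0"])
      (use shear_derivatives(1)[OF F f'] z in auto)
  moreover have "dy (dy F) z = f'' (snd z) *\<^sub>R v"
    by (rule shear_derivatives(2)[of _ f' v f'']) (use shear_derivatives(2)[OF F f'] f'' z in auto)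
  ultimately show ?thesis
    by (simp add: laplacian_def)
qed

lemma shear_divergence:
  assumes F: "\<And>w. w \<in> channel \<Longrightarrow> F w = (f (snd w), g (snd w))"
    and f': "\<And>y. y \<in> {-1<..<1} \<Longrightarrow> (f has_real_derivative f' y) (at y)"
    and g': "\<And>y. y \<in> {-1<..<1} \<Longrightarrow> (g has_real_derivative g' y) (at y)"
    and z: "z \<in> channel"
  shows "divergence F z = g' (snd z)"
proof -
  have "dx (\<lambda>w. fst (F w)) z = 0"
    by (rule shear_derivatives(1)[of _ f 1 f']) (simp_all add: F f' z)
  moreover have "dy (\<lambda>w. snd (F w)) z = g' (snd z) *\<^sub>R 1"
    by (rule shear_derivatives(2)[of _ g 1 g']) (simp_all add: F g' z)
  ultimately show ?thesis
    by (simp add: divergence_def)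
qed

text \<open>
  Advection vanishes since \<open>u\<close> is horizontal and no field depends
  on \<open>x\<close>.  The relations \<open>\<nabla>c\<^sub>+ = - c\<^sub>+ \<nabla>\<phi>\<close> and \<open>\<nabla>c\<^sub>- = c\<^sub>- \<nabla>\<phi>\<close> leave only the horizontal drift
  fluxes, which are independent of \<open>x\<close>, and give \<open>\<nabla>p = - \<gamma> \<rho> \<nabla>\<phi>\<close>.  What remains of the
  momentum balance is \<open>\<nu> U'' + \<gamma> \<rho> E0 = 0\<close>, which holds by the Poisson equation for the chosen
  multiple of \<open>\<phi>\<close> in \<open>U\<close>; an affine part of \<open>U\<close> does not contribute.
\<close>

lemma sheared_boltzmann_equilibrium:
  fixes u :: "real \<times> real \<Rightarrow> real \<times> real" and p cp cm \<Phi> :: "real \<times> real \<Rightarrow> real"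
  assumes \<nu>: "\<nu> > 0" and lD: "lD > 0"
    and \<phi>': "\<And>y. y \<in> {-1<..<1} \<Longrightarrow> (\<phi> has_real_derivative \<phi>' y) (at y)"
    and \<phi>'': "\<And>y. y \<in> {-1<..<1} \<Longrightarrow>
                (\<phi>' has_real_derivative 2 * c0 / lD\<^sup>2 * sinh (\<phi> y)) (at y)"
    and U: "U = (\<lambda>y. A * y + B + \<gamma> * lD\<^sup>2 / \<nu> * E0 * \<phi> y)"
    and u: "u = (\<lambda>(x, y). U y *\<^sub>R e1)"
    and p: "p = (\<lambda>(x, y). \<gamma> * (c0 * exp (- \<phi> y) + c0 * exp (\<phi> y)) + p0)"
    and cp: "cp = (\<lambda>(x, y). c0 * exp (- \<phi> y))"
    and cm: "cm = (\<lambda>(x, y). c0 * exp (\<phi> y))"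
    and \<Phi>: "\<Phi> = (\<lambda>(x, y). \<phi> y)"
  shows "pnp_ns_equations \<nu> Dp Dm lD \<gamma> E0 UNIV
           (\<lambda>t. u) (\<lambda>t. p) (\<lambda>t. cp) (\<lambda>t. cm) (\<lambda>t. \<Phi>)"
  unfolding pnp_ns_equations_def Let_def
proof (intro ballI conjI)
  fix t :: real and z assume z: "z \<in> channel"
  let ?y = "snd z"
  have c_at: "cp w = c0 * exp (- \<phi> (snd w))" "cm w = c0 * exp (\<phi> (snd w))" for w
    by (simp_all add: cp cm case_prod_beta)
  define \<rho> where "\<rho> = cp z - cm z"
  have \<rho>: "\<rho> = - 2 * c0 * sinh (\<phi> ?y)"
    by (simp add: \<rho>_def c_at sinh_def algebra_simps)
  have dt: "dt UNIV (\<lambda>t. f) t z = 0" for f :: "real \<times> real \<Rightarrow> 'c::real_normed_vector"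
    by (simp add: dt_def vector_derivative_const_at)
  have u': "(U has_real_derivative A + \<gamma> * lD\<^sup>2 / \<nu> * E0 * \<phi>' y) (at y)" if "y \<in> {-1<..<1}" for y
    unfolding U by (rule derivative_eq_intros \<phi>'[OF that] refl)+ simp
  have u'': "((\<lambda>y. A + \<gamma> * lD\<^sup>2 / \<nu> * E0 * \<phi>' y) has_real_derivative
      \<gamma> * lD\<^sup>2 / \<nu> * E0 * (2 * c0 / lD\<^sup>2 * sinh (\<phi> y))) (at y)" if "y \<in> {-1<..<1}" for y
    by (rule derivative_eq_intros \<phi>''[OF that] refl)+ simp
  have cp': "((\<lambda>y. c0 * exp (- \<phi> y)) has_real_derivative - (c0 * exp (- \<phi> y) * \<phi>' y)) (at y)"
    if "y \<in> {-1<..<1}" for y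
    by (rule derivative_eq_intros \<phi>'[OF that] refl)+ simp
  have cm': "((\<lambda>y. c0 * exp (\<phi> y)) has_real_derivative c0 * exp (\<phi> y) * \<phi>' y) (at y)"
    if "y \<in> {-1<..<1}" for y
    by (rule derivative_eq_intros \<phi>'[OF that] refl)+ simp
  have p': "((\<lambda>y. \<gamma> * (c0 * exp (- \<phi> y) + c0 * exp (\<phi> y)) + p0) has_real_derivative
      \<gamma> * (- (c0 * exp (- \<phi> y) * \<phi>' y) + c0 * exp (\<phi> y) * \<phi>' y)) (at y)"
    if "y \<in> {-1<..<1}" for y
    by (rule derivative_eq_intros cp'[OF that] cm'[OF that] refl)+ simp
  have d_u: "dx u w = 0" if "w \<in> channel" for w
    using shear_derivatives(1)[OF _ u' that, of u e1] by (simp add: u case_prod_beta)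
  have grad_p: "grad p w = (0, \<gamma> * (- (cp w * \<phi>' (snd w)) + cm w * \<phi>' (snd w)))" if "w \<in> channel" for w
    using shear_derivatives[OF _ p' that, of p 1]
    by (simp add: grad_def p c_at case_prod_beta)
  have grad_cp: "grad cp w = (0, - (cp w * \<phi>' (snd w)))" if "w \<in> channel" for w
    using shear_derivatives[OF _ cp' that, of cp 1] by (simp add: grad_def c_at)
  have grad_cm: "grad cm w = (0, cm w * \<phi>' (snd w))" if "w \<in> channel" for w
    using shear_derivatives[OF _ cm' that, of cm 1] by (simp add: grad_def c_at)
  have grad_\<Phi>: "grad \<Phi> w = (0, \<phi>' (snd w))" if "w \<in> channel" for w
    using shear_derivatives[OF _ \<phi>' that, of \<Phi> 1] by (simp add: grad_def \<Phi> case_prod_beta)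
  have laplacian_u: "laplacian u z = (\<gamma> * lD\<^sup>2 / \<nu> * E0 * (2 * c0 / lD\<^sup>2 * sinh (\<phi> ?y))) *\<^sub>R e1"
    by (rule shear_laplacian[OF _ u' u'' z]) (simp add: u case_prod_beta)
  have laplacian_\<Phi>: "laplacian \<Phi> z = (2 * c0 / lD\<^sup>2 * sinh (\<phi> ?y)) *\<^sub>R 1"
    by (rule shear_laplacian[OF _ \<phi>' \<phi>'' z]) (simp add: \<Phi> case_prod_beta)
  have advect: "advect u f z = 0" if "dx f z = 0" for f :: "real \<times> real \<Rightarrow> 'c::real_normed_vector"
    using that by (simp add: advect_def u case_prod_beta e1_def)
  have dx_c: "dx cp z = 0" "dx cm z = 0"
    using grad_cp[OF z] grad_cm[OF z] by (simp_all add: grad_def)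
  have flux_p: "divergence (\<lambda>w. grad cp w + cp w *\<^sub>R grad \<Phi> w - (E0 * cp w) *\<^sub>R e1) z = 0"
    by (rule shear_divergence[of _ "\<lambda>y. - E0 * (c0 * exp (- \<phi> y))" "\<lambda>_. 0", OF _ DERIV_cmult[OF cp'] _ z])
      (simp_all add: grad_cp grad_\<Phi> e1_def c_at)
  have flux_m: "divergence (\<lambda>w. grad cm w - cm w *\<^sub>R grad \<Phi> w + (E0 * cm w) *\<^sub>R e1) z = 0"
    by (rule shear_divergence[of _ "\<lambda>y. E0 * (c0 * exp (\<phi> y))" "\<lambda>_. 0", OF _ DERIV_cmult[OF cm'] _ z])
      (simp_all add: grad_cm grad_\<Phi> e1_def c_at)
  have div_u: "divergence u z = 0"
    by (rule shear_divergence[of _ U "\<lambda>_. 0", OF _ u' _ z])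
      (simp_all add: u e1_def case_prod_beta)
  show "dt UNIV (\<lambda>t. u) t z + advect u u z + grad p z
      = \<nu> *\<^sub>R laplacian u z + (\<gamma> * (cp z - cm z)) *\<^sub>R (E0 *\<^sub>R e1 - grad \<Phi> z)"
  proof -
    have "\<nu> *\<^sub>R laplacian u z = - (\<gamma> * \<rho> * E0) *\<^sub>R e1"
      using \<nu> lD by (simp add: laplacian_u \<rho> e1_def)
    then show ?thesis
      unfolding dt advect[OF d_u[OF z]] grad_p[OF z] grad_\<Phi>[OF z] \<rho>_def[symmetric]
      by (simp add: e1_def \<rho>_def algebra_simps)
  qed
  show "divergence u z = 0"
    by (rule div_u)
  show "dt UNIV (\<lambda>t. cp) t z + advect u cp z
      = Dp * divergence (\<lambda>w. grad cp w + cp w *\<^sub>R grad \<Phi> w - (E0 * cp w) *\<^sub>R e1) z"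
    by (simp add: dt advect dx_c flux_p)
  show "dt UNIV (\<lambda>t. cm) t z + advect u cm z
      = Dm * divergence (\<lambda>w. grad cm w - cm w *\<^sub>R grad \<Phi> w + (E0 * cm w) *\<^sub>R e1) z"
    by (simp add: dt advect dx_c flux_m)
  show "- (lD\<^sup>2) * laplacian \<Phi> z = cp z - cm z"
    unfolding \<rho>_def[symmetric] laplacian_\<Phi> \<rho> using lD by simp
qed

section \<open>The Poisson--Boltzmann problem\<close>

text \<open>
  Brings an arbitrary solution into the form to which the maximum principle applies; smoothness in
  the open interval is what makes \<open>deriv\<close> return genuine first and second derivatives.
\<close>

lemma poisson_boltzmann_derivatives:
  assumes "poisson_boltzmann lD c0 \<zeta>p \<zeta>m \<psi>" "lD > 0" "y \<in> {-1<..<1}"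
  shows "(\<psi> has_real_derivative deriv \<psi> y) (at y)"
    "(deriv \<psi> has_real_derivative 2 * c0 / lD\<^sup>2 * sinh (\<psi> y)) (at y)"
proof -
  let ?I = "{-1<..<1::real}"
  have "smooth_on ?I \<psi>"
    using assms(1) by (simp add: poisson_boltzmann_def)
  then obtain \<psi>' where \<psi>': "smooth_on ?I \<psi>'"
    "\<And>y. y \<in> ?I \<Longrightarrow> (\<psi> has_real_derivative \<psi>' y) (at y)"
    using smooth_on_real_derivative[OF _ open_greaterThanLessThan] by blast
  have deriv: "deriv \<psi> y = \<psi>' y" if "y \<in> ?I" for y
    using DERIV_imp_deriv[OF \<psi>'(2)[OF that]] .
  then show "(\<psi> has_real_derivative deriv \<psi> y) (at y)"
    using \<psi>'(2) assms(3) by simp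
  obtain \<psi>'' where "(\<psi>' has_real_derivative \<psi>'' y) (at y)"
    using smooth_on_real_derivative[OF \<psi>'(1) open_greaterThanLessThan] assms(3) by blast
  then have d: "(deriv \<psi> has_real_derivative \<psi>'' y) (at y)"
    by (rule has_field_derivative_transform_within_open[OF _ _ assms(3)]) (simp_all add: deriv)
  have "- (lD\<^sup>2) * deriv (deriv \<psi>) y = c0 * exp (- \<psi> y) - c0 * exp (\<psi> y)"
    using assms(1,3) unfolding poisson_boltzmann_def by blast
  then have "\<psi>'' y = 2 * c0 / lD\<^sup>2 * sinh (\<psi> y)"
    using \<open>lD > 0\<close> DERIV_imp_deriv[OF d] by (simp add: sinh_def field_simps)
  with d show "(deriv \<psi> has_real_derivative 2 * c0 / lD\<^sup>2 * sinh (\<psi> y)) (at y)"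
    by simp
qed

text \<open>
  Where \<open>\<phi> > \<psi>\<close>, monotonicity of \<open>sinh\<close> makes \<open>\<phi> - \<psi>\<close> strictly convex, so the maximum principle
  applies.  Exchanging the two solutions yields uniqueness.
\<close>

lemma poisson_boltzmann_le:
  assumes \<phi>: "poisson_boltzmann lD c0 \<zeta>p \<zeta>m \<phi>" and \<psi>: "poisson_boltzmann lD c0 \<zeta>p \<zeta>m \<psi>"
    and pos: "lD > 0" "c0 > 0" and y: "y \<in> {-1..1}"
  shows "\<phi> y \<le> \<psi> y"
proof -
  have "\<phi> y - \<psi> y \<le> 0"
  proof (rule weak_maximum_principle[of "-1" 1 "\<lambda>y. \<phi> y - \<psi> y" "\<lambda>y. deriv \<phi> y - deriv \<psi> y"
        "\<lambda>y. 2 * c0 / lD\<^sup>2 * sinh (\<phi> y) - 2 * c0 / lD\<^sup>2 * sinh (\<psi> y)"])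
    show "continuous_on {-1..1} (\<lambda>y. \<phi> y - \<psi> y)"
      using \<phi> \<psi> unfolding poisson_boltzmann_def by (intro continuous_on_diff) auto
    show "0 < 2 * c0 / lD\<^sup>2 * sinh (\<phi> y) - 2 * c0 / lD\<^sup>2 * sinh (\<psi> y)" if "0 < \<phi> y - \<psi> y" for y
    proof -
      have "0 < 2 * c0 / lD\<^sup>2 * (sinh (\<phi> y) - sinh (\<psi> y))"
        using that pos by (intro mult_pos_pos) auto
      then show ?thesis
        by (simp only: right_diff_distrib)
    qed
  next
    fix y :: real assume "y \<in> {-1<..<1}"
    note d = poisson_boltzmann_derivatives[OF \<phi> pos(1) this] poisson_boltzmann_derivatives[OF \<psi> pos(1) this]
    show "((\<lambda>y. \<phi> y - \<psi> y) has_real_derivative deriv \<phi> y - deriv \<psi> y) (at y)"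
      by (rule DERIV_diff[OF d(1,3)])
    show "((\<lambda>y. deriv \<phi> y - deriv \<psi> y) has_real_derivative
        2 * c0 / lD\<^sup>2 * sinh (\<phi> y) - 2 * c0 / lD\<^sup>2 * sinh (\<psi> y)) (at y)"
      by (rule DERIV_diff[OF d(2,4)])
  qed (use \<phi> \<psi> y in \<open>simp_all add: poisson_boltzmann_def\<close>)
  then show ?thesis by simp
qed

definition solution_algebra :: "(real \<Rightarrow> real) \<Rightarrow> (real \<Rightarrow> real) \<Rightarrow> (real \<Rightarrow> real) set" where
  "solution_algebra \<phi> \<phi>' =
     generated_algebra {\<lambda>y. y, \<phi>, \<phi>', \<lambda>y. exp (\<phi> y), \<lambda>y. exp (- \<phi> y)}"

text \<open>
  The derivative of the generator \<open>\<phi>'\<close> is \<open>k sinh \<phi>\<close>, which is where the differential equation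
  enters and why both exponentials are among the generators.
\<close>

lemma solution_algebra_derivative:
  assumes \<phi>: "solves_dirichlet a b (\<lambda>y. k * sinh (\<phi> y)) \<phi> \<phi>'"
    and f: "f \<in> solution_algebra \<phi> \<phi>'"
  shows "\<exists>f'\<in>solution_algebra \<phi> \<phi>'. \<forall>y\<in>{-1..1}. (f has_real_derivative f' y) (at y within {-1..1})"
  using f unfolding solution_algebra_def
proof (rule generated_algebra_derivative[rotated])
  let ?G = "{\<lambda>y. y, \<phi>, \<phi>', \<lambda>y. exp (\<phi> y), \<lambda>y. exp (- \<phi> y)}"
  let ?A = "generated_algebra ?G"
  have d: "(\<phi> has_real_derivative \<phi>' y) (at y within {-1..1})"
    "(\<phi>' has_real_derivative k * sinh (\<phi> y)) (at y within {-1..1})" if "y \<in> {-1..1}" for y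
    using \<phi> that unfolding solves_dirichlet_def by blast+
  have gens: "\<phi> \<in> ?A" "\<phi>' \<in> ?A" "(\<lambda>y. exp (\<phi> y)) \<in> ?A" "(\<lambda>y. exp (- \<phi> y)) \<in> ?A"
    by (simp_all add: generated_algebra.generator)
  have "(\<lambda>y. k / 2 * (exp (\<phi> y) + (-1) * exp (- \<phi> y))) \<in> ?A"
    by (intro generated_algebra.mult generated_algebra.add generated_algebra.const gens)
  moreover have "(\<lambda>y. k / 2 * (exp (\<phi> y) + (-1) * exp (- \<phi> y))) = (\<lambda>y. k * sinh (\<phi> y))"
    by (simp add: sinh_def fun_eq_iff)
  ultimately have sinh: "(\<lambda>y. k * sinh (\<phi> y)) \<in> ?A"
    by simp
  fix f assume "f \<in> ?G"
  then consider "f = (\<lambda>y. y)" | "f = \<phi>" | "f = \<phi>'" | "f = (\<lambda>y. exp (\<phi> y))" | "f = (\<lambda>y. exp (- \<phi> y))"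
    by blast
  then show "\<exists>f'\<in>?A. \<forall>y\<in>{-1..1}. (f has_real_derivative f' y) (at y within {-1..1})"
  proof cases
    case 1
    show ?thesis
      by (rule bexI[OF _ generated_algebra.const[of 1]]) (simp add: 1)
  next
    case 2
    show ?thesis
      by (rule bexI[OF _ gens(2)]) (simp add: 2 d)
  next
    case 3
    show ?thesis
      by (rule bexI[OF _ sinh]) (simp add: 3 d)
  next
    case 4
    have "((\<lambda>y. exp (\<phi> y)) has_real_derivative exp (\<phi> y) * \<phi>' y) (at y within {-1..1})"
      if "y \<in> {-1..1}" for y
      by (rule derivative_eq_intros d(1)[OF that] refl)+
    then show ?thesis
      unfolding 4 by (intro bexI[OF _ generated_algebra.mult[OF gens(3) gens(2)]] ballI)
  next
    case 5
    have "((\<lambda>y. exp (- \<phi> y)) has_real_derivative (-1) * (exp (- \<phi> y) * \<phi>' y)) (at y within {-1..1})"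
      if "y \<in> {-1..1}" for y
      by (rule derivative_eq_intros d(1)[OF that] refl)+ simp
    then show ?thesis
      unfolding 5 by (intro bexI[OF _ generated_algebra.mult[OF generated_algebra.const[of "-1"]
              generated_algebra.mult[OF gens(4) gens(2)]]] ballI)
  qed
qed

lemma admissible_shear_field:
  assumes \<phi>: "solves_dirichlet a b (\<lambda>y. k * sinh (\<phi> y)) \<phi> \<phi>'"
    and f: "f \<in> solution_algebra \<phi> \<phi>'"
  shows "admissible_field UNIV (\<lambda>t (x, y). f y *\<^sub>R v)"
  unfolding admissible_field_def
proof (intro conjI ballI)
  have "smooth_on (UNIV \<times> closed_channel) (\<lambda>z :: real \<times> real \<times> real. f (snd (snd z)) *\<^sub>R v)"
  proof (rule smooth_on_pullback[OF solution_algebra_derivative[OF \<phi>] f])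
    show "bounded_linear (\<lambda>z :: real \<times> real \<times> real. snd (snd z))"
      by (intro bounded_linear_intros)
  qed (auto simp: closed_channel_def)
  then show "smooth_on (UNIV \<times> closed_channel) (\<lambda>(t :: real, z). case z of (x, y) \<Rightarrow> f y *\<^sub>R v)"
    by (simp add: case_prod_beta')
qed (simp add: x_periodic_def)

lemma poisson_boltzmann_of_sinh:
  assumes \<phi>: "solves_dirichlet \<zeta>m \<zeta>p (\<lambda>y. 2 * c0 / lD\<^sup>2 * sinh (\<phi> y)) \<phi> \<phi>'" and "lD > 0"
  shows "poisson_boltzmann lD c0 \<zeta>p \<zeta>m \<phi>"
  unfolding poisson_boltzmann_def
proof (intro conjI ballI)
  have mem: "\<phi> \<in> solution_algebra \<phi> \<phi>'"
    by (simp add: solution_algebra_def generated_algebra.generator)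
  have "smooth_on {-1<..<1} (\<lambda>y. \<phi> y *\<^sub>R (1::real))"
    by (rule smooth_on_pullback[OF solution_algebra_derivative[OF \<phi>] mem bounded_linear_ident]) auto
  then show "smooth_on {-1<..<1} \<phi>"
    by simp
  show "continuous_on {-1..1} \<phi>"
    by (rule solves_dirichlet_continuous_on[OF \<phi>])
  show "\<phi> 1 = \<zeta>p" "\<phi> (-1) = \<zeta>m"
    using \<phi> by (simp_all add: solves_dirichlet_def)
  fix y :: real assume y: "y \<in> {-1<..<1}"
  have "(deriv \<phi> has_real_derivative 2 * c0 / lD\<^sup>2 * sinh (\<phi> y)) (at y)"
    by (rule has_field_derivative_transform_within_open[OF solves_dirichlet_interior(2)[OF \<phi> y] _ y])
      (simp_all add: DERIV_imp_deriv[OF solves_dirichlet_interior(1)[OF \<phi>]])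
  from DERIV_imp_deriv[OF this]
  show "- (lD\<^sup>2) * deriv (deriv \<phi>) y = c0 * exp (- \<phi> y) - c0 * exp (\<phi> y)"
    using \<open>lD > 0\<close> by (simp add: sinh_def field_simps)
qed

section \<open>The steady state\<close>

theorem proposition2p1:
  fixes \<nu> Dp Dm lD \<gamma> c0 E0 Up Um \<zeta>p \<zeta>m :: real
  assumes "\<nu> > 0" and "Dp > 0" and "Dm > 0" and "lD > 0" and "\<gamma> > 0" and "c0 > 0"
  shows "\<exists>\<phi>s. poisson_boltzmann lD c0 \<zeta>p \<zeta>m \<phi>s \<and>
    (\<forall>\<psi>. poisson_boltzmann lD c0 \<zeta>p \<zeta>m \<psi> \<longrightarrow> (\<forall>y\<in>{-1..1}. \<psi> y = \<phi>s y)) \<and>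
    (let chi = \<gamma> * lD\<^sup>2 / \<nu>;
         cps = (\<lambda>y. c0 * exp (- \<phi>s y));
         cms = (\<lambda>y. c0 * exp (\<phi>s y));
         Us = (\<lambda>y. couette Up Um y + chi * E0 * (\<phi>s y - ell \<zeta>p \<zeta>m y))
     in \<forall>p0. pnp_ns_steady_state \<nu> Dp Dm lD \<gamma> E0 Up Um \<zeta>p \<zeta>m c0
          (\<lambda>(x, y). Us y *\<^sub>R e1)
          (\<lambda>(x, y). \<gamma> * (cps y + cms y) + p0)
          (\<lambda>(x, y). cps y)
          (\<lambda>(x, y). cms y)
          (\<lambda>(x, y). \<phi>s y))"
proof -
  have "2 * c0 / lD\<^sup>2 > 0"
    using assms by simp
  then obtain \<phi> \<phi>' where \<phi>: "solves_dirichlet \<zeta>m \<zeta>p (\<lambda>y. 2 * c0 / lD\<^sup>2 * sinh (\<phi> y)) \<phi> \<phi>'"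
    using sinh_dirichlet_solvable by blast
  note pb = poisson_boltzmann_of_sinh[OF \<phi> \<open>lD > 0\<close>]
  define chi where "chi = \<gamma> * lD\<^sup>2 / \<nu>"
  define U where "U = (\<lambda>y. couette Up Um y + chi * E0 * (\<phi> y - ell \<zeta>p \<zeta>m y))"
  \<comment> \<open>The linear interpolant of the boundary potentials is affine and is absorbed, together with the
    Couette flow, into the affine part of the velocity profile.\<close>
  have U: "U = (\<lambda>y. ((Up - Um) / 2 - chi * E0 * (\<zeta>p - \<zeta>m) / 2) * y
      + ((Up + Um) / 2 - chi * E0 * (\<zeta>p + \<zeta>m) / 2) + chi * E0 * \<phi> y)"
    by (simp add: U_def couette_def ell_def fun_eq_iff field_simps)
  let ?A = "solution_algebra \<phi> \<phi>'"
  note alg = generated_algebra.const generated_algebra.add generated_algebra.mult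
  have gens: "(\<lambda>y. y) \<in> ?A" "\<phi> \<in> ?A" "(\<lambda>y. exp (\<phi> y)) \<in> ?A" "(\<lambda>y. exp (- \<phi> y)) \<in> ?A"
    by (simp_all add: solution_algebra_def generated_algebra.generator)
  have profiles: "U \<in> ?A" "(\<lambda>y. c0 * exp (- \<phi> y)) \<in> ?A" "(\<lambda>y. c0 * exp (\<phi> y)) \<in> ?A"
    "(\<lambda>y. \<gamma> * (c0 * exp (- \<phi> y) + c0 * exp (\<phi> y)) + p0) \<in> ?A" for p0
    unfolding U solution_algebra_def by (rule gens[unfolded solution_algebra_def] alg)+
  have "pnp_ns_steady_state \<nu> Dp Dm lD \<gamma> E0 Up Um \<zeta>p \<zeta>m c0 (\<lambda>(x, y). U y *\<^sub>R e1)
      (\<lambda>(x, y). \<gamma> * (c0 * exp (- \<phi> y) + c0 * exp (\<phi> y)) + p0)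
      (\<lambda>(x, y). c0 * exp (- \<phi> y)) (\<lambda>(x, y). c0 * exp (\<phi> y)) (\<lambda>(x, y). \<phi> y)" for p0
    unfolding pnp_ns_steady_state_def pnp_ns_solution_def
  proof (intro conjI)
    note admissible = admissible_shear_field[OF \<phi>]
    show "admissible_field UNIV (\<lambda>t (x, y). U y *\<^sub>R e1)"
      by (rule admissible[OF profiles(1)])
    show "admissible_field UNIV (\<lambda>t :: real. \<lambda>(x :: real, y). \<gamma> * (c0 * exp (- \<phi> y) + c0 * exp (\<phi> y)) + p0)"
      using admissible[OF profiles(4), of p0 "1::real"] by simp
    show "admissible_field UNIV (\<lambda>t :: real. \<lambda>(x :: real, y). c0 * exp (- \<phi> y))"
      using admissible[OF profiles(2), of "1::real"] by simp
    show "admissible_field UNIV (\<lambda>t :: real. \<lambda>(x :: real, y). c0 * exp (\<phi> y))"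
      using admissible[OF profiles(3), of "1::real"] by simp
    show "admissible_field UNIV (\<lambda>t :: real. \<lambda>(x :: real, y). \<phi> y)"
      using admissible[OF gens(2), of "1::real"] by simp
    show "pnp_ns_equations \<nu> Dp Dm lD \<gamma> E0 UNIV (\<lambda>t (x, y). U y *\<^sub>R e1)
        (\<lambda>t (x, y). \<gamma> * (c0 * exp (- \<phi> y) + c0 * exp (\<phi> y)) + p0)
        (\<lambda>t (x, y). c0 * exp (- \<phi> y)) (\<lambda>t (x, y). c0 * exp (\<phi> y)) (\<lambda>t (x, y). \<phi> y)"
      by (rule sheared_boltzmann_equilibrium[OF \<open>\<nu> > 0\<close> \<open>lD > 0\<close>
            solves_dirichlet_interior[OF \<phi>] U[unfolded chi_def] refl refl refl refl refl])
    show "pnp_ns_boundary Up Um \<zeta>p \<zeta>m c0 UNIV (\<lambda>t (x, y). U y *\<^sub>R e1)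
        (\<lambda>t (x, y). c0 * exp (- \<phi> y)) (\<lambda>t (x, y). c0 * exp (\<phi> y)) (\<lambda>t (x, y). \<phi> y)"
      using \<phi> by (simp add: pnp_ns_boundary_def solves_dirichlet_def U_def couette_def ell_def
          e1_def field_simps)
  qed
  moreover have "\<psi> y = \<phi> y" if "poisson_boltzmann lD c0 \<zeta>p \<zeta>m \<psi>" "y \<in> {-1..1}" for \<psi> y
    using poisson_boltzmann_le[OF that(1) pb] poisson_boltzmann_le[OF pb that(1)] assms that(2)
    by (meson order_antisym)
  ultimately show ?thesis
    unfolding Let_def using pb unfolding U_def chi_def by (intro exI[of _ \<phi>] conjI) blast+
qed

end
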